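(* For every prime $q>3$, the number $b(4q)$ of isomorphism classes of (left) braces of order $4q$ is $$b(4q)=\begin{cases}9 & \text{if } 4\nmid q-1,\\ 11 & \text{if } 4\mid q-1.\end{cases}$$
   Context: A (left) brace is a (here finite) abelian group $(A,+)$ with a binary operation $\cdot$ such that for all $a,b,c\in A$: $a\cdot(b+c)=a\cdot b+a\cdot c$; $(a\cdot b+a+b)\cdot c=a\cdot(b\cdot c)+a\cdot c+b\cdot c$; and $x\mapsto a\cdot x+x$ is bijective. Isomorphisms of braces are bijections preserving $+$ and $\cdot$. The order of a brace is its cardinality, and $b(n)$ is the number of isomorphism classes of left braces of order $n$. *)

theory Defs
  imports "HOL-Algebra.Ring" "HOL-Algebra.Coset" "HOL-Computational_Algebra.Primes"
begin

text \<open>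
  A brace is carried by a \<^typ>\<open>'a ring\<close> record, so that \<open>\<oplus>\<close> is the addition and
  \<open>\<otimes>\<close> the operation \<open>\<cdot>\<close>. As in \<^locale>\<open>abelian_group\<close>, the field \<open>one\<close> of the record
  plays no role: no axiom mentions it, and isomorphisms need not preserve it.
\<close>

locale left_brace = abelian_group A for A (structure) +
  assumes finite_carrier: "finite (carrier A)"
    and mult_closed: "\<lbrakk>a \<in> carrier A; b \<in> carrier A\<rbrakk> \<Longrightarrow> a \<otimes> b \<in> carrier A"
    and left_distrib:
      "\<lbrakk>a \<in> carrier A; b \<in> carrier A; c \<in> carrier A\<rbrakk>
        \<Longrightarrow> a \<otimes> (b \<oplus> c) = a \<otimes> b \<oplus> a \<otimes> c"
    and brace_law:
      "\<lbrakk>a \<in> carrier A; b \<in> carrier A; c \<in> carrier A\<rbrakk>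
        \<Longrightarrow> (a \<otimes> b \<oplus> a \<oplus> b) \<otimes> c = a \<otimes> (b \<otimes> c) \<oplus> a \<otimes> c \<oplus> b \<otimes> c"
    and translation_bij:
      "a \<in> carrier A \<Longrightarrow> bij_betw (\<lambda>x. a \<otimes> x \<oplus> x) (carrier A) (carrier A)"

definition brace_iso :: "('a, 'm) ring_scheme \<Rightarrow> ('b, 'n) ring_scheme \<Rightarrow> ('a \<Rightarrow> 'b) set" where
  "brace_iso A B =
    {h. bij_betw h (carrier A) (carrier B) \<and>
        (\<forall>x\<in>carrier A. \<forall>y\<in>carrier A.
          h (x \<oplus>\<^bsub>A\<^esub> y) = h x \<oplus>\<^bsub>B\<^esub> h y \<and> h (x \<otimes>\<^bsub>A\<^esub> y) = h x \<otimes>\<^bsub>B\<^esub> h y)}"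

definition brace_isomorphic :: "('a, 'm) ring_scheme \<Rightarrow> ('b, 'n) ring_scheme \<Rightarrow> bool" where
  "brace_isomorphic A B \<longleftrightarrow> brace_iso A B \<noteq> {}"

text \<open>
  Isomorphism classes are counted among braces whose elements are natural numbers; by
  \<open>left_brace_isomorphic_nat\<close> below, every finite brace is isomorphic to one of these.
\<close>

definition braces_of_order :: "nat \<Rightarrow> nat ring set" where
  "braces_of_order n = {A. left_brace A \<and> order A = n}"

definition brace_isomorphism_rel :: "nat \<Rightarrow> nat ring rel" where
  "brace_isomorphism_rel n =
    {(A, B). A \<in> braces_of_order n \<and> B \<in> braces_of_order n \<and> brace_isomorphic A B}"

definition num_braces :: "nat \<Rightarrow> nat" where
  "num_braces n = card (braces_of_order n // brace_isomorphism_rel n)"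

lemma (in left_brace) brace_iso_inv:
  assumes h: "h \<in> brace_iso A B"
  shows "inv_into (carrier A) h \<in> brace_iso B A"
proof -
  let ?g = "inv_into (carrier A) h"
  have bij: "bij_betw h (carrier A) (carrier B)"
    and hadd: "\<And>x y. \<lbrakk>x \<in> carrier A; y \<in> carrier A\<rbrakk> \<Longrightarrow> h (x \<oplus> y) = h x \<oplus>\<^bsub>B\<^esub> h y"
    and hmult: "\<And>x y. \<lbrakk>x \<in> carrier A; y \<in> carrier A\<rbrakk> \<Longrightarrow> h (x \<otimes> y) = h x \<otimes>\<^bsub>B\<^esub> h y"
    using h by (auto simp: brace_iso_def)
  have gin: "?g u \<in> carrier A" and hg: "h (?g u) = u" if "u \<in> carrier B" for u
    using that bij by (auto simp: bij_betw_def inv_into_into f_inv_into_f)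
  have gh: "?g (h x) = x" if "x \<in> carrier A" for x
    using that bij by (simp add: bij_betw_def)
  have "?g (u \<oplus>\<^bsub>B\<^esub> v) = ?g u \<oplus> ?g v" if "u \<in> carrier B" "v \<in> carrier B" for u v
    using hadd[OF gin gin, OF that] gh[of "?g u \<oplus> ?g v"] gin that by (simp add: hg)
  moreover have "?g (u \<otimes>\<^bsub>B\<^esub> v) = ?g u \<otimes> ?g v" if "u \<in> carrier B" "v \<in> carrier B" for u v
    using hmult[OF gin gin, OF that] gh[of "?g u \<otimes> ?g v"] gin that mult_closed by (simp add: hg)
  ultimately show ?thesis
    by (simp add: brace_iso_def bij_betw_inv_into[OF bij])
qed

lemma brace_iso_comp:
  assumes "h \<in> brace_iso A B" "k \<in> brace_iso B C"
  shows "k \<circ> h \<in> brace_iso A C"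
proof -
  have "bij_betw (k \<circ> h) (carrier A) (carrier C)"
    using assms by (auto simp: brace_iso_def intro: bij_betw_trans)
  moreover have "h x \<in> carrier B" if "x \<in> carrier A" for x
    using assms(1) that by (auto simp: brace_iso_def bij_betw_def)
  ultimately show ?thesis
    using assms by (simp add: brace_iso_def)
qed

lemma equiv_brace_isomorphism_rel: "equiv (braces_of_order n) (brace_isomorphism_rel n)"
proof (rule equivI)
  show "brace_isomorphism_rel n \<subseteq> braces_of_order n \<times> braces_of_order n"
    by (auto simp: brace_isomorphism_rel_def)
  have "id \<in> brace_iso A A" for A :: "nat ring"
    by (simp add: brace_iso_def)
  then show "refl_on (braces_of_order n) (brace_isomorphism_rel n)"
    by (auto simp: refl_on_def brace_isomorphism_rel_def brace_isomorphic_def)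
  show "sym (brace_isomorphism_rel n)"
  proof (rule symI)
    fix A B assume AB: "(A, B) \<in> brace_isomorphism_rel n"
    then obtain h where h: "h \<in> brace_iso A B" and "left_brace A"
      by (auto simp: brace_isomorphism_rel_def brace_isomorphic_def braces_of_order_def)
    from left_brace.brace_iso_inv[OF this(2) h] AB show "(B, A) \<in> brace_isomorphism_rel n"
      by (auto simp: brace_isomorphism_rel_def brace_isomorphic_def)
  qed
  show "trans (brace_isomorphism_rel n)"
  proof (rule transI)
    fix A B C
    assume *: "(A, B) \<in> brace_isomorphism_rel n" "(B, C) \<in> brace_isomorphism_rel n"
    then obtain h k where "h \<in> brace_iso A B" "k \<in> brace_iso B C"
      by (auto simp: brace_isomorphism_rel_def brace_isomorphic_def)
    from brace_iso_comp[OF this] * show "(A, C) \<in> brace_isomorphism_rel n"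
      by (auto simp: brace_isomorphism_rel_def brace_isomorphic_def)
  qed
qed

lemma (in left_brace) left_brace_transfer:
  assumes h: "h \<in> brace_iso A B" and zero: "h \<zero> = \<zero>\<^bsub>B\<^esub>"
  shows "left_brace B"
proof -
  have bij: "bij_betw h (carrier A) (carrier B)"
    and hadd: "\<And>x y. \<lbrakk>x \<in> carrier A; y \<in> carrier A\<rbrakk> \<Longrightarrow> h x \<oplus>\<^bsub>B\<^esub> h y = h (x \<oplus> y)"
    and hmult: "\<And>x y. \<lbrakk>x \<in> carrier A; y \<in> carrier A\<rbrakk> \<Longrightarrow> h x \<otimes>\<^bsub>B\<^esub> h y = h (x \<otimes> y)"
    using h by (auto simp: brace_iso_def)
  have carB: "carrier B = h ` carrier A"
    using bij by (simp add: bij_betw_def)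
  note [simp] = hadd hmult mult_closed zero[symmetric]
  interpret B: abelian_group B
  proof (rule abelian_groupI)
    fix u assume "u \<in> carrier B"
    then obtain x where x: "x \<in> carrier A" "u = h x"
      by (auto simp: carB)
    then have "h (\<ominus> x) \<oplus>\<^bsub>B\<^esub> u = \<zero>\<^bsub>B\<^esub>"
      by (simp add: l_neg)
    then show "\<exists>v\<in>carrier B. v \<oplus>\<^bsub>B\<^esub> u = \<zero>\<^bsub>B\<^esub>"
      using x by (auto simp: carB)
  qed (auto simp: carB a_ac)
  show ?thesis
  proof unfold_locales
    show "finite (carrier B)"
      using finite_carrier by (simp add: carB)
  next
    fix u assume "u \<in> carrier B"
    then obtain a where a: "a \<in> carrier A" "u = h a"
      by (auto simp: carB)
    have "bij_betw (h \<circ> (\<lambda>x. a \<otimes> x \<oplus> x) \<circ> inv_into (carrier A) h) (carrier B) (carrier B)"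
      by (intro bij_betw_trans[OF bij_betw_inv_into[OF bij]]
          bij_betw_trans[OF translation_bij[OF a(1)]] bij)
    moreover have "(h \<circ> (\<lambda>x. a \<otimes> x \<oplus> x) \<circ> inv_into (carrier A) h) v = u \<otimes>\<^bsub>B\<^esub> v \<oplus>\<^bsub>B\<^esub> v"
      if "v \<in> carrier B" for v
      using that a bij_betw_imp_inj_on[OF bij] by (auto simp: carB)
    ultimately show "bij_betw (\<lambda>v. u \<otimes>\<^bsub>B\<^esub> v \<oplus>\<^bsub>B\<^esub> v) (carrier B) (carrier B)"
      by (rule bij_betw_cong[THEN iffD1, rotated])
  qed (auto simp: carB left_distrib brace_law)
qed

lemma (in left_brace) left_brace_isomorphic_nat:
  "\<exists>B \<in> braces_of_order (order A). brace_isomorphic A B"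
proof -
  obtain h :: "'a \<Rightarrow> nat" where inj: "inj_on h (carrier A)"
    using finite_imp_inj_to_nat_seg[OF finite_carrier] by blast
  let ?g = "inv_into (carrier A) h"
  define B :: "nat ring" where
    "B = \<lparr>carrier = h ` carrier A, monoid.mult = (\<lambda>u v. h (?g u \<otimes> ?g v)), one = undefined,
          zero = h \<zero>, add = (\<lambda>u v. h (?g u \<oplus> ?g v))\<rparr>"
  have h: "h \<in> brace_iso A B"
    using inj by (simp add: brace_iso_def B_def bij_betw_def)
  moreover have "left_brace B"
    by (rule left_brace_transfer[OF h]) (simp add: B_def)
  moreover have "order B = order A"
    using inj by (simp add: order_def B_def card_image)
  ultimately show ?thesis
    by (auto simp: braces_of_order_def brace_isomorphic_def)
qed

end

(*
  Write lambda_a(x) = a x + x, so that the multiplicative group is a o b = a + lambda_a(b) and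
  lambda is an action of it by additive automorphisms. A brace A of order 4q is additively
  <g> + K with g of order q and |K| = 4; both parts are characteristic, hence stable under lambda.
  An element x of <g> acts trivially: on <g> because otherwise x o y = y would have a solution y,
  and on K because lambda_x^q = 1 while |K| < q. So A is determined by the brace K of order 4
  together with a character chi : (K, o) -> (Z/q)^*, where lambda_k(g) = chi(k) g, and isomorphism
  of braces is equivalence under Aut(K). There are four braces K, two with (K, o) cyclic and two
  with (K, o) elementary abelian; counting characters modulo Aut(K) gives 2 + 2 + 2 + 3, and one
  more for each of the two cyclic (K, o) if -1 is a square modulo q.
*)
theory Submission
  imports Defs "HOL-Number_Theory.Euler_Criterion" "HOL-Algebra.Sylow"
begin

section \<open>Counting isomorphism classes\<close>

text \<open>The representatives may live on any type, so the models can be built on pairs. Each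
  \<open>R i\<close> is replaced by an isomorphic copy \<open>N i\<close> on the naturals, and
  sending \<open>i\<close> to the class of \<open>N i\<close> is a bijection onto the
  quotient.\<close>

lemma num_braces_eq_card:
  fixes R :: "'i \<Rightarrow> 'a ring"
  assumes fin: "finite I"
    and brace: "\<And>i. i \<in> I \<Longrightarrow> left_brace (R i)" "\<And>i. i \<in> I \<Longrightarrow> order (R i) = n"
    and distinct: "\<And>i j. \<lbrakk>i \<in> I; j \<in> I; brace_isomorphic (R i) (R j)\<rbrakk> \<Longrightarrow> i = j"
    and complete: "\<And>A :: nat ring. A \<in> braces_of_order n \<Longrightarrow> \<exists>i\<in>I. brace_isomorphic (R i) A"
  shows "num_braces n = card I"
proof -
  let ?rel = "brace_isomorphism_rel n"
  have "\<forall>i\<in>I. \<exists>B. B \<in> braces_of_order n \<and> brace_isomorphic (R i) B"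
    using left_brace.left_brace_isomorphic_nat[OF brace(1)] brace(2) by fastforce
  then obtain N where N: "\<And>i. i \<in> I \<Longrightarrow> N i \<in> braces_of_order n"
    "\<And>i. i \<in> I \<Longrightarrow> brace_isomorphic (R i) (N i)"
    by metis
  have sym: "brace_isomorphic B C" if "left_brace C" "brace_isomorphic C B"
    for B :: "nat ring" and C :: "'a ring"
    using that left_brace.brace_iso_inv by (fastforce simp: brace_isomorphic_def)
  have trans: "brace_isomorphic B D" if "brace_isomorphic B C" "brace_isomorphic C D"
    for B :: "('b, 'c) ring_scheme" and C :: "('d, 'e) ring_scheme" and D :: "('f, 'g) ring_scheme"
    using that brace_iso_comp by (fastforce simp: brace_isomorphic_def)
  have inj: "i = j" if ij: "i \<in> I" "j \<in> I" and "(N i, N j) \<in> ?rel" for i j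
  proof (rule distinct[OF ij])
    have "brace_isomorphic (N i) (N j)"
      using that by (simp add: brace_isomorphism_rel_def)
    then show "brace_isomorphic (R i) (R j)"
      by (meson N brace ij sym trans)
  qed
  have "bij_betw (\<lambda>i. ?rel `` {N i}) I (braces_of_order n // ?rel)"
    unfolding bij_betw_def
  proof
    show "inj_on (\<lambda>i. ?rel `` {N i}) I"
      by (rule inj_onI) (metis inj N(1) eq_equiv_class equiv_brace_isomorphism_rel)
    have "X \<in> (\<lambda>i. ?rel `` {N i}) ` I" if X: "X \<in> braces_of_order n // ?rel" for X
    proof -
      obtain A where A: "A \<in> braces_of_order n" "X = ?rel `` {A}"
        using X by (auto elim: quotientE)
      then obtain i where i: "i \<in> I" "brace_isomorphic (R i) A"
        using complete by blast
      then have "brace_isomorphic (N i) A"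
        by (meson N(2) brace(1) sym trans)
      then have "(N i, A) \<in> ?rel"
        using A(1) N(1) i(1) by (simp add: brace_isomorphism_rel_def)
      then have "?rel `` {N i} = X"
        using A(2) equiv_class_eq[OF equiv_brace_isomorphism_rel] by metis
      then show ?thesis using i(1) by blast
    qed
    then show "(\<lambda>i. ?rel `` {N i}) ` I = braces_of_order n // ?rel"
      using N(1) by (auto intro: quotientI)
  qed
  then show ?thesis
    by (simp add: num_braces_def bij_betw_same_card)
qed

section \<open>The model braces\<close>

text \<open>
  A brace of order 4 is encoded on \<open>{..<4}\<close>: addition \<open>padd v\<close> is addition modulo 4, except
  that for \<open>v\<close> the sum of two odd elements is corrected by 2, which gives the Klein four-group;
  the product is \<open>twist w\<close>. So \<open>v\<close> and \<open>w\<close> tell whether \<open>(K, +)\<close> is elementary and whether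
  the brace is nontrivial, and \<open>(K, \<circ>)\<close> is cyclic iff \<open>v = w\<close>. The numbers \<open>c\<close> and \<open>d\<close> are the
  values of the character at 1 and 2.
\<close>

definition character :: "int \<Rightarrow> int \<Rightarrow> nat \<Rightarrow> int" where
  "character c d p = c ^ (p mod 2) * d ^ (p div 2)"

definition twist :: "bool \<Rightarrow> nat \<Rightarrow> nat \<Rightarrow> nat" where
  "twist b p r = (if b \<and> odd p \<and> odd r then 2 else 0)"

definition padd :: "bool \<Rightarrow> nat \<Rightarrow> nat \<Rightarrow> nat" where
  "padd v p r = (p + r + twist v p r) mod 4"

text \<open>The product is lambda minus the identity, hence the factor
  \<open>character c d p - 1\<close>: an element with second component \<open>p\<close> acts on the
  first component by multiplication with the character value.\<close>

definition model :: "int \<Rightarrow> bool \<Rightarrow> bool \<Rightarrow> int \<Rightarrow> int \<Rightarrow> (int \<times> nat) ring" where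
  "model q v w c d =
    \<lparr>carrier = {0..<q} \<times> {..<4},
     monoid.mult = (\<lambda>(x, p) (y, r). (((character c d p - 1) * y) mod q, twist w p r)),
     one = undefined,
     zero = (0, 0),
     add = (\<lambda>(x, p) (y, r). ((x + y) mod q, padd v p r))\<rparr>"

text \<open>These relations make the character multiplicative modulo \<open>q\<close>:
  \<open>2 \<circ> 2 = 0\<close>, while \<open>1 \<circ> 1\<close> is 2 in the cyclic case
  \<open>v = w\<close> and 0 otherwise.\<close>

definition admissible :: "int \<Rightarrow> bool \<Rightarrow> bool \<Rightarrow> int \<Rightarrow> int \<Rightarrow> bool" where
  "admissible q v w c d \<longleftrightarrow> [d\<^sup>2 = 1] (mod q) \<and> [c\<^sup>2 = (if v = w then d else 1)] (mod q)"

lemma all_less_4: "(\<forall>p<4. P p) \<longleftrightarrow> P 0 \<and> P 1 \<and> P 2 \<and> P (3::nat)"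
  by (simp add: numeral_eq_Suc All_less_Suc) blast

lemma padd_less [simp]: "padd v p r < 4"
  by (simp add: padd_def)

lemma twist_less [simp]: "twist v p r < 4"
  by (simp add: twist_def)

lemma padd_commute: "padd v p r = padd v r p"
  by (simp add: padd_def twist_def add.commute)

lemma padd_0 [simp]: "r < 4 \<Longrightarrow> padd v 0 r = r"
  by (simp add: padd_def twist_def)

lemma padd_assoc [rule_format]:
  "\<forall>p<4. \<forall>r<4. \<forall>s<4. padd v (padd v p r) s = padd v p (padd v r s)"
  by (cases v) (simp_all add: all_less_4 padd_def twist_def)

lemma padd_inverse [rule_format]: "\<forall>p<4. \<exists>r<4. padd v r p = 0"
proof (intro allI impI)
  fix p :: nat assume "p < 4"
  have "\<forall>p<4. padd v (if v then p else (4 - p) mod 4) p = 0"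
    by (cases v) (simp_all add: all_less_4 padd_def twist_def)
  with \<open>p < 4\<close> show "\<exists>r<4. padd v r p = 0"
    by (intro exI[of _ "if v then p else (4 - p) mod 4"]) auto
qed

lemma twist_padd [rule_format]:
  "\<forall>p<4. \<forall>r<4. \<forall>s<4. twist w p (padd v r s) = padd v (twist w p r) (twist w p s)"
  by (cases v; cases w) (simp_all add: all_less_4 padd_def twist_def)

text \<open>Twists are even, so the nested twist vanishes and \<open>p \<circ> r\<close> has the
  parity of \<open>p + r\<close>; both sides are determined by parities. This is the brace law in
  order 4.\<close>

lemma twist_circle [rule_format]:
  "\<forall>p<4. \<forall>r<4. \<forall>s<4.
    twist w (padd v (padd v (twist w p r) p) r) s =
    padd v (padd v (twist w p (twist w r s)) (twist w p s)) (twist w r s)"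
  by (cases v; cases w) (simp_all add: all_less_4 padd_def twist_def)

lemma padd_twist_inj [rule_format]:
  "\<forall>p<4. \<forall>r<4. \<forall>s<4. padd v (twist w p r) r = padd v (twist w p s) s \<longrightarrow> r = s"
  by (cases v; cases w) (simp_all add: all_less_4 padd_def twist_def)

lemma character_0 [simp]: "character c d 0 = 1"
  by (simp add: character_def)

text \<open>The left-hand side is \<open>p \<circ> r\<close>.\<close>

lemma circle_eq_padd [rule_format]:
  "\<forall>p<4. \<forall>r<4. padd v (padd v (twist w p r) p) r = padd (v \<noteq> w) p r"
  by (cases v; cases w) (simp_all add: all_less_4 padd_def twist_def)

lemma character_padd:
  assumes "admissible q v w c d" "p < 4" "r < 4"
  shows "[character c d (padd (v \<noteq> w) p r) = character c d p * character c d r] (mod q)"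
proof -
  have d: "[1 = d * d] (mod q)" and c: "[(if v = w then d else 1) = c * c] (mod q)"
    using assms(1) by (auto simp: admissible_def power2_eq_square cong_sym)
  \<comment> \<open>The next congruences treat the pairs containing 3, whose value is
    \<open>c * d\<close>: \<open>c1\<close> pairs it with 2, \<open>c2\<close> with 1,
    \<open>c3\<close> with itself.\<close>
  have c1: "[c = d * (c * d)] (mod q)" "[c = c * d * d] (mod q)"
    using cong_scalar_left[OF d, of c] by (simp_all add: ac_simps)
  have c2: "[(if v = w then 1 else d) = c * (c * d)] (mod q)"
     "[(if v = w then 1 else d) = c * d * c] (mod q)"
    using cong_mult[OF c cong_refl[of d]] cong_trans[OF d]
    by (auto simp: ac_simps split: if_splits)
  have c3: "[(if v = w then d else 1) = c * d * (c * d)] (mod q)"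
    using cong_mult[OF c d] by (simp add: ac_simps)
  have "\<forall>p<4. \<forall>r<4. [character c d (padd (v \<noteq> w) p r) = character c d p * character c d r] (mod q)"
    using c c1 c2 c3 d unfolding all_less_4
    by (cases "v = w") (simp_all add: twist_def character_def padd_def mult.commute[of d c])
  with assms(2,3) show ?thesis by blast
qed

text \<open>\<open>d\<close> is a unit since its square is 1, and \<open>c\<close> since its square
  is 1 or \<open>d\<close>. Bijectivity of the translations in the model rests on this.\<close>

lemma coprime_character:
  assumes "admissible q v w c d"
  shows "coprime (character c d p) q"
proof -
  have "coprime (d\<^sup>2) q"
    using assms cong_imp_coprime[of 1 "d\<^sup>2" q] by (auto simp: admissible_def cong_sym)
  then have d: "coprime d q" by simp
  have "coprime (c\<^sup>2) q"
    using assms d cong_imp_coprime[of "if v = w then d else 1" "c\<^sup>2" q]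
    by (auto simp: admissible_def cong_sym split: if_splits)
  with d show ?thesis by (simp add: character_def)
qed

lemma order_model: "order (model (int q) v w c d) = 4 * q"
  by (simp add: order_def model_def card_cartesian_product)

lemma left_brace_model:
  assumes adm: "admissible q v w c d" and q: "q > 0"
  shows "left_brace (model q v w c d)" (is "left_brace ?M")
proof -
  interpret abelian_group ?M
  proof (rule abelian_groupI)
    fix a assume "a \<in> carrier ?M"
    then obtain x p where a: "a = (x, p)" "0 \<le> x" "x < q" "p < 4"
      by (auto simp: model_def)
    obtain r where "r < 4" "padd v r p = 0"
      using padd_inverse a by blast
    then have "((- x) mod q, r) \<in> carrier ?M \<and> ((- x) mod q, r) \<oplus>\<^bsub>?M\<^esub> a = \<zero>\<^bsub>?M\<^esub>"
      using a q by (auto simp: model_def mod_simps)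
    then show "\<exists>b\<in>carrier ?M. b \<oplus>\<^bsub>?M\<^esub> a = \<zero>\<^bsub>?M\<^esub>" by blast
  qed (use q in \<open>auto simp: model_def mod_simps padd_assoc algebra_simps intro: padd_commute\<close>)
  show ?thesis
  proof unfold_locales
    show fin: "finite (carrier ?M)"
      by (simp add: model_def)
    show "a \<otimes>\<^bsub>?M\<^esub> b \<in> carrier ?M" if "a \<in> carrier ?M" "b \<in> carrier ?M" for a b
      using that q by (auto simp: model_def)
    show "a \<otimes>\<^bsub>?M\<^esub> (b \<oplus>\<^bsub>?M\<^esub> c) = a \<otimes>\<^bsub>?M\<^esub> b \<oplus>\<^bsub>?M\<^esub> a \<otimes>\<^bsub>?M\<^esub> c"
      if "a \<in> carrier ?M" "b \<in> carrier ?M" "c \<in> carrier ?M" for a b c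
      using that q by (auto simp: model_def mod_simps twist_padd distrib_left)
    show "(a \<otimes>\<^bsub>?M\<^esub> b \<oplus>\<^bsub>?M\<^esub> a \<oplus>\<^bsub>?M\<^esub> b) \<otimes>\<^bsub>?M\<^esub> z =
        a \<otimes>\<^bsub>?M\<^esub> (b \<otimes>\<^bsub>?M\<^esub> z) \<oplus>\<^bsub>?M\<^esub> a \<otimes>\<^bsub>?M\<^esub> z \<oplus>\<^bsub>?M\<^esub> b \<otimes>\<^bsub>?M\<^esub> z"
      if abz: "a \<in> carrier ?M" "b \<in> carrier ?M" "z \<in> carrier ?M" for a b z
    proof -
      obtain x p y r t s where [simp]: "a = (x, p)" "b = (y, r)" "z = (t, s)"
        by (metis surj_pair)
      let ?k = "character c d"
      \<comment> \<open>In the first component the brace law reduces to multiplicativity of the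
        character, as \<open>(k - 1) * (l - 1) + (k - 1) + (l - 1) = k * l - 1\<close>.\<close>
      have "[(?k (padd v (padd v (twist w p r) p) r) - 1) * t = (?k p * ?k r - 1) * t] (mod q)"
        using abz circle_eq_padd[of p r v w] character_padd[OF adm, of p r]
        by (intro cong_mult cong_diff) (auto simp: model_def)
      then have "((?k (padd v (padd v (twist w p r) p) r) - 1) * t) mod q =
          ((?k p - 1) * ((?k r - 1) * t) + (?k p - 1) * t + (?k r - 1) * t) mod q"
        by (simp add: cong_def algebra_simps)
      then show ?thesis
        using abz by (auto simp: model_def mod_simps twist_circle)
    qed
    show "bij_betw (\<lambda>x. a \<otimes>\<^bsub>?M\<^esub> x \<oplus>\<^bsub>?M\<^esub> x) (carrier ?M) (carrier ?M)" if a: "a \<in> carrier ?M" for a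
    proof -
      obtain x p where [simp]: "a = (x, p)" and p: "p < 4"
        using a by (auto simp: model_def)
      let ?k = "character c d p"
      have *: "y = z" if "0 \<le> y" "y < q" "0 \<le> z" "z < q"
        "((?k - 1) * y + y) mod q = ((?k - 1) * z + z) mod q" for y z
      proof -
        have "[?k * y = ?k * z] (mod q)"
          using that(5) by (simp add: cong_def algebra_simps)
        then have "[y = z] (mod q)"
          using coprime_character[OF adm] by (simp add: cong_mult_lcancel)
        then show ?thesis
          using that by (simp add: cong_def)
      qed
      have "inj_on (\<lambda>x. a \<otimes>\<^bsub>?M\<^esub> x \<oplus>\<^bsub>?M\<^esub> x) (carrier ?M)"
      proof (rule inj_onI)
        fix b b' assume b: "b \<in> carrier ?M" "b' \<in> carrier ?M"
          "a \<otimes>\<^bsub>?M\<^esub> b \<oplus>\<^bsub>?M\<^esub> b = a \<otimes>\<^bsub>?M\<^esub> b' \<oplus>\<^bsub>?M\<^esub> b'"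
        obtain y r z s where [simp]: "b = (y, r)" "b' = (z, s)"
          by (metis surj_pair)
        have "r = s"
          using b p by (intro padd_twist_inj[of p r s v w]) (simp_all add: model_def)
        moreover have "y = z"
          using b by (intro *[of y z]) (simp_all add: model_def mod_simps)
        ultimately show "b = b'" by simp
      qed
      moreover have "(\<lambda>x. a \<otimes>\<^bsub>?M\<^esub> x \<oplus>\<^bsub>?M\<^esub> x) ` carrier ?M \<subseteq> carrier ?M"
        using q by (auto simp: model_def)
      ultimately show ?thesis
        using fin by (simp add: bij_betw_def endo_inj_surj)
    qed
  qed
qed

text \<open>
  Representatives of the characters modulo the automorphisms of the brace of order 4: the exchange
  of 1 and 3 replaces \<open>c\<close> by \<open>c d\<close>, and the trivial brace on the Klein four-group also allows
  the exchange of 1 and 2. The set \<open>S\<close> holds a square root of -1 modulo \<open>q\<close>, if there is one.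
\<close>

definition parameters :: "int set \<Rightarrow> (bool \<times> bool \<times> int \<times> int) set" where
  "parameters S = {(v, w, c, d).
     d = 1 \<and> c \<in> {1, - 1} \<or> v = False \<and> w = True \<and> c = 1 \<and> d = - 1 \<or> v = w \<and> c \<in> S \<and> d = - 1}"

text \<open>Eight parameters have \<open>d = 1\<close> and a ninth has \<open>d = - 1\<close>; a
  root \<open>s\<close> adds one for each of the two choices with \<open>v = w\<close>, both new
  because the ninth has \<open>v \<noteq> w\<close>.\<close>

lemma card_parameters: "card (parameters {}) = 9" "card (parameters {s}) = 11"
proof -
  have "parameters {} = {(v, w, c, 1) |v w c. c \<in> {1, - 1}} \<union> {(False, True, 1, - 1)}"
    by (auto simp: parameters_def)
  also have "{(v, w, c, 1) |v w c. c \<in> {1, - 1 :: int}} = UNIV \<times> UNIV \<times> {1, - 1} \<times> {1 :: int}"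
    by auto
  finally have *: "parameters {} = (UNIV \<times> UNIV \<times> {1, - 1} \<times> {1}) \<union> {(False, True, 1, - 1)}" .
  show 9: "card (parameters {}) = 9"
    unfolding * by (subst card_Un_disjoint) (auto simp: card_cartesian_product)
  have "parameters {s} = parameters {} \<union> {(False, False, s, - 1), (True, True, s, - 1)}"
    by (auto simp: parameters_def)
  moreover have "finite (parameters {})"
    unfolding * by simp
  moreover have "parameters {} \<inter> {(False, False, s, - 1), (True, True, s, - 1)} = {}"
    by (auto simp: parameters_def)
  ultimately show "card (parameters {s}) = 11"
    by (simp add: 9 card_Un_disjoint del: Un_insert_right)
qed

lemma admissible_parameters:
  assumes "(v, w, c, d) \<in> parameters S" "\<And>s. s \<in> S \<Longrightarrow> [s\<^sup>2 = - 1] (mod q)"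
  shows "admissible q v w c d"
  using assms by (auto simp: parameters_def admissible_def)

section \<open>Distinguishing the models\<close>

text \<open>The sizes of the 2-torsion of the additive group, of the socle (the kernel of lambda),
  and of the set of common fixed points of all lambda maps.\<close>

definition brace_invariant :: "('a, 'm) ring_scheme \<Rightarrow> nat \<times> nat \<times> nat" where
  "brace_invariant A =
    (card {a \<in> carrier A. a \<oplus>\<^bsub>A\<^esub> a = \<zero>\<^bsub>A\<^esub>},
     card {a \<in> carrier A. \<forall>b\<in>carrier A. a \<otimes>\<^bsub>A\<^esub> b = \<zero>\<^bsub>A\<^esub>},
     card {b \<in> carrier A. \<forall>a\<in>carrier A. a \<otimes>\<^bsub>A\<^esub> b = \<zero>\<^bsub>A\<^esub>})"

lemma brace_invariant_eq:
  assumes "left_brace A" "left_brace B" "brace_isomorphic A B"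
  shows "brace_invariant A = brace_invariant B"
proof -
  interpret A: left_brace A by fact
  interpret B: left_brace B by fact
  obtain h where bij: "bij_betw h (carrier A) (carrier B)"
    and hadd: "\<And>x y. \<lbrakk>x \<in> carrier A; y \<in> carrier A\<rbrakk> \<Longrightarrow> h (x \<oplus>\<^bsub>A\<^esub> y) = h x \<oplus>\<^bsub>B\<^esub> h y"
    and hmult: "\<And>x y. \<lbrakk>x \<in> carrier A; y \<in> carrier A\<rbrakk> \<Longrightarrow> h (x \<otimes>\<^bsub>A\<^esub> y) = h x \<otimes>\<^bsub>B\<^esub> h y"
    using assms(3) by (auto simp: brace_isomorphic_def brace_iso_def)
  have inj: "inj_on h (carrier A)" and carB: "carrier B = h ` carrier A"
    using bij by (auto simp: bij_betw_def)
  have "h \<zero>\<^bsub>A\<^esub> \<oplus>\<^bsub>B\<^esub> h \<zero>\<^bsub>A\<^esub> = h \<zero>\<^bsub>A\<^esub>"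
    using hadd[of "\<zero>\<^bsub>A\<^esub>" "\<zero>\<^bsub>A\<^esub>"] by simp
  then have h0: "h \<zero>\<^bsub>A\<^esub> = \<zero>\<^bsub>B\<^esub>"
    by (simp add: carB B.add.r_cancel_one)
  then have zero: "h x = \<zero>\<^bsub>B\<^esub> \<longleftrightarrow> x = \<zero>\<^bsub>A\<^esub>" if "x \<in> carrier A" for x
    using inj_on_eq_iff[OF inj that A.zero_closed] by simp
  have eq: "card {b \<in> carrier B. Q b} = card {a \<in> carrier A. P a}"
    if "\<And>a. a \<in> carrier A \<Longrightarrow> Q (h a) = P a" for P Q
  proof -
    have "{b \<in> carrier B. Q b} = h ` {a \<in> carrier A. P a}"
      using that by (auto simp: carB)
    then show ?thesis
      using inj by (simp add: card_image inj_on_subset)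
  qed
  show ?thesis
    unfolding brace_invariant_def prod.inject
    by (intro conjI eq[symmetric])
      (simp_all add: carB zero A.mult_closed flip: hadd hmult)
qed

lemma card_less_4:
  "card {p. p < 4 \<and> P p} = of_bool (P 0) + of_bool (P 1) + of_bool (P 2) + of_bool (P (3::nat))"
proof -
  have "card {p. p < 4 \<and> P p} = (\<Sum>p\<in>{p \<in> {..<4}. P p}. 1)"
    by simp
  also have "\<dots> = (\<Sum>p<4. of_bool (P p))"
    by (subst sum.inter_filter) (auto simp: of_bool_def)
  finally show ?thesis by (simp add: numeral_eq_Suc)
qed

lemma brace_invariant_model:
  assumes q: "prime q" "q > 3"
  shows "brace_invariant (model (int q) v w c d) =
    ((if v then 4 else 2),
     q * card {p. p < 4 \<and> [character c d p = 1] (mod int q) \<and> \<not> (w \<and> odd p)},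
     (if [c = 1] (mod int q) \<and> [d = 1] (mod int q) then q else 1) * (if w then 2 else 4))"
    (is "brace_invariant ?M = _")
proof -
  let ?k = "character c d" and ?q = "int q"
  have small: "x = 0" if "?q dvd x" "0 \<le> x" "x < ?q" for x
    using that zdvd_not_zless by force
  have prm: "?q dvd x * y \<longleftrightarrow> ?q dvd x \<or> ?q dvd y" for x y
    using q(1) by (simp add: prime_dvd_mult_iff)
  have n2: "\<not> ?q dvd 2"
    using q(2) by (auto dest: zdvd_imp_le)
  have dbl: "x = 0" if "?q dvd 2 * x" "0 \<le> x" "x < ?q" for x
    using that small n2 prm[of 2 x] by blast
  have "{a \<in> carrier ?M. a \<oplus>\<^bsub>?M\<^esub> a = \<zero>\<^bsub>?M\<^esub>} = {0} \<times> {p. p < 4 \<and> padd v p p = 0}"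
    using q by (auto simp: model_def mod_eq_0_iff_dvd dest: dbl)
  moreover have "card {p. p < 4 \<and> padd v p p = 0} = (if v then 4 else 2)"
    unfolding card_less_4 by (simp add: padd_def twist_def)
  moreover have "{a \<in> carrier ?M. \<forall>b\<in>carrier ?M. a \<otimes>\<^bsub>?M\<^esub> b = \<zero>\<^bsub>?M\<^esub>} =
      {0..<?q} \<times> {p. p < 4 \<and> [?k p = 1] (mod ?q) \<and> \<not> (w \<and> odd p)}" (is "?L = ?R")
  proof (intro equalityI subsetI)
    fix a assume a: "a \<in> ?L"
    \<comment> \<open>Testing against this one element suffices: it exposes both
      \<open>character c d p - 1\<close> and the twist by an odd element.\<close>
    moreover have "(1, 1) \<in> carrier ?M"
      using q by (simp add: model_def)
    ultimately have "a \<otimes>\<^bsub>?M\<^esub> (1, 1) = \<zero>\<^bsub>?M\<^esub>" by blast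
    with a show "a \<in> ?R"
      by (auto simp: model_def twist_def cong_iff_dvd_diff mod_eq_0_iff_dvd split: if_splits)
  next
    fix a assume "a \<in> ?R"
    then show "a \<in> ?L"
      by (auto simp: model_def twist_def cong_iff_dvd_diff mod_eq_0_iff_dvd)
  qed
  moreover have "{b \<in> carrier ?M. \<forall>a\<in>carrier ?M. a \<otimes>\<^bsub>?M\<^esub> b = \<zero>\<^bsub>?M\<^esub>} =
      (if [c = 1] (mod ?q) \<and> [d = 1] (mod ?q) then {0..<?q} else {0}) \<times> {r. r < 4 \<and> \<not> (w \<and> odd r)}"
    (is "?L = ?R")
  proof (intro equalityI subsetI)
    fix b assume b: "b \<in> ?L"
    \<comment> \<open>These two elements exhibit the values \<open>c\<close> and \<open>d\<close>,
      which determine the whole character; the first also exhibits the twist.\<close>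
    moreover have "(0, 1) \<in> carrier ?M" "(0, 2) \<in> carrier ?M"
      using q by (simp_all add: model_def)
    ultimately have "(0, 1) \<otimes>\<^bsub>?M\<^esub> b = \<zero>\<^bsub>?M\<^esub>" "(0, 2) \<otimes>\<^bsub>?M\<^esub> b = \<zero>\<^bsub>?M\<^esub>" by blast+
    with b show "b \<in> ?R"
      using small
      by (auto simp: model_def twist_def character_def prm cong_iff_dvd_diff mod_eq_0_iff_dvd
          split: if_splits)
  next
    fix b assume b: "b \<in> ?R"
    have "[?k p = 1] (mod ?q)" if "[c = 1] (mod ?q)" "[d = 1] (mod ?q)" for p
      using cong_mult[OF cong_pow[OF that(1)] cong_pow[OF that(2)]] by (simp add: character_def)
    with b q show "b \<in> ?L"
      by (auto simp: model_def twist_def cong_iff_dvd_diff mod_eq_0_iff_dvd split: if_splits)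
  qed
  moreover have "card {r::nat. r < 4 \<and> \<not> (w \<and> odd r)} = (if w then 2 else 4)"
    unfolding card_less_4 by simp
  ultimately show ?thesis
    unfolding brace_invariant_def by (simp add: card_cartesian_product)
qed

text \<open>The 2-torsion gives \<open>v\<close>, the fixed points give \<open>w\<close> and whether
  the character is trivial, and the socle has size \<open>q\<close> exactly when
  \<open>d = - 1\<close>. For \<open>d = 1\<close>, triviality tells \<open>c = 1\<close> from
  \<open>c = - 1\<close>; for \<open>d = - 1\<close>, \<open>c\<close> follows from \<open>v\<close>
  and \<open>w\<close>, as \<open>S\<close> has at most one element.\<close>

lemma parameters_eq_if_model_isomorphic:
  assumes q: "prime q" "q > 3" and s: "\<And>s. s \<in> S \<Longrightarrow> [s\<^sup>2 = - 1] (mod int q)" "S \<subseteq> {r}"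
    and x: "(v, w, c, d) \<in> parameters S" and y: "(v', w', c', d') \<in> parameters S"
    and iso: "brace_isomorphic (model (int q) v w c d) (model (int q) v' w' c' d')"
  shows "(v, w, c, d) = (v', w', c', d')"
proof -
  let ?N = "\<lambda>w c d. card {p. p < 4 \<and> [character c d p = 1] (mod int q) \<and> \<not> (w \<and> odd p)}"
  let ?t = "\<lambda>c d. [c = 1] (mod int q) \<and> [d = 1] (mod int q)"
  have adm: "admissible (int q) v w c d" if "(v, w, c, d) \<in> parameters S" for v w c d
    using admissible_parameters[OF that] s by blast
  have "brace_invariant (model (int q) v w c d) = brace_invariant (model (int q) v' w' c' d')"
    using q by (intro brace_invariant_eq left_brace_model adm x y iso) auto
  then have v: "v = v'" and N: "?N w c d = ?N w' c' d'"
    and F: "(if ?t c d then q else 1) * (if w then 2 else 4) =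
            (if ?t c' d' then q else 1) * (if w' then 2 else 4 :: nat)"
    using q(2) by (auto simp: brace_invariant_model[OF q] split: if_splits)
  have w: "w = w'" "?t c d = ?t c' d'"
    using F q(2) by (auto split: if_splits)
  have m1: "\<not> [- 1 = 1] (mod int q)" "\<not> [1 = - 1] (mod int q)"
    using q(2) by (auto simp: cong_iff_dvd_diff dest: zdvd_imp_le)
  have s1: "\<not> [s = 1] (mod int q)" "\<not> [- s = 1] (mod int q)" if "s \<in> S" for s
    using m1(1) cong_pow[of s 1 "int q" 2] cong_pow[of "- s" 1 "int q" 2]
      cong_trans[OF cong_sym[OF s(1)[OF that]]]
    by auto
  \<comment> \<open>For \<open>d = - 1\<close> only \<open>p = 0\<close> is counted: if
    \<open>c = 1\<close>, then \<open>w\<close> holds and excludes \<open>p = 1\<close>; if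
    \<open>c\<close> is a root of -1, neither \<open>c\<close> nor \<open>- c\<close> is 1.\<close>
  have d: "(?N w c d = 1) = (d = - 1)" "?t c d = (c = 1 \<and> d = 1)"
    if "(v, w, c, d) \<in> parameters S" for v w c d
    using that m1 s1
    by (auto simp: parameters_def card_less_4 character_def numeral_3_eq_3)
  have "d = - 1 \<longleftrightarrow> d' = - 1"
    using d(1)[OF x] d(1)[OF y] N by simp
  moreover have "(c = 1 \<and> d = 1) \<longleftrightarrow> (c' = 1 \<and> d' = 1)"
    using d(2)[OF x] d(2)[OF y] w(2) by simp
  ultimately show ?thesis
    using x y v w s(2) by (auto simp: parameters_def)
qed

section \<open>The structure of a brace of order 4q\<close>

lemma funpow_mult_fixed:
  assumes "(f ^^ n) y = y"
  shows "(f ^^ (n * m)) y = y"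
  using assms by (induction m) (simp_all add: funpow_add)

text \<open>By the pigeonhole principle \<open>y\<close> has a period of at most
  \<open>card S\<close>, hence smaller than \<open>p\<close> and coprime to it; by Bezout, a
  multiple of it exceeds a multiple of \<open>p\<close> by 1.\<close>

lemma fixed_if_funpow_prime_fixed:
  assumes p: "prime p" and S: "finite S" "card S < p" "f ` S \<subseteq> S"
    and y: "y \<in> S" "(f ^^ p) y = y"
  shows "f y = y"
proof -
  have mem: "(f ^^ i) y \<in> S" for i
    using y(1) S(3) by (induction i) auto
  have "card ((\<lambda>i. (f ^^ i) y) ` {..card S}) \<le> card S"
    using S(1) mem by (intro card_mono) auto
  then have "\<not> inj_on (\<lambda>i. (f ^^ i) y) {..card S}"
    by (intro pigeonhole) simp
  then obtain i j where ij: "i < j" "j \<le> card S" "(f ^^ i) y = (f ^^ j) y"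
    unfolding inj_on_def by (metis atMost_iff linorder_neqE_nat)
  \<comment> \<open>\<open>f\<close> may fail to be injective, so \<open>i\<close> iterations cannot
    be cancelled; instead \<open>p - i\<close> further ones complete them to the period
    \<open>p\<close>.\<close>
  have "y = (f ^^ (p - i + i)) y"
    using ij S(2) y(2) by simp
  also have "\<dots> = (f ^^ (p - i + j)) y"
    using ij(3) by (simp add: funpow_add)
  also have "p - i + j = j - i + p"
    using ij S(2) by simp
  also have "(f ^^ (j - i + p)) y = (f ^^ (j - i)) ((f ^^ p) y)"
    by (simp add: funpow_add)
  finally have k: "(f ^^ (j - i)) y = y"
    using y(2) by simp
  have "coprime (j - i) p"
    using p ij S(2) by (intro prime_imp_coprime_nat[THEN coprime_commute[THEN iffD1]]) (auto dest: dvd_imp_le)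
  then obtain a b where ab: "(j - i) * a = p * b + 1"
    using bezout_nat[of "j - i" p] ij(1) by auto
  have "f y = f ((f ^^ (p * b)) y)"
    using funpow_mult_fixed[OF y(2)] by simp
  also have "\<dots> = (f ^^ ((j - i) * a)) y"
    by (simp add: ab)
  also have "\<dots> = y"
    using funpow_mult_fixed[OF k] by simp
  finally show ?thesis .
qed

section \<open>The action lambda and the circle group\<close>

context left_brace
begin

text \<open>\<open>lam a\<close> is the action \<open>\<lambda>\<^sub>a\<close>, and \<open>a \<oplus> lam a b\<close> is the product \<open>a \<circ> b\<close>.\<close>

definition lam :: "'a \<Rightarrow> 'a \<Rightarrow> 'a" where
  "lam a x = a \<otimes> x \<oplus> x"

lemma lam_closed [simp]: "\<lbrakk>a \<in> carrier A; x \<in> carrier A\<rbrakk> \<Longrightarrow> lam a x \<in> carrier A"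
  by (simp add: lam_def mult_closed)

lemma lam_add:
  "\<lbrakk>a \<in> carrier A; x \<in> carrier A; y \<in> carrier A\<rbrakk> \<Longrightarrow> lam a (x \<oplus> y) = lam a x \<oplus> lam a y"
  by (simp add: lam_def left_distrib mult_closed a_ac)

lemma lam_bij: "a \<in> carrier A \<Longrightarrow> bij_betw (lam a) (carrier A) (carrier A)"
  using translation_bij by (simp add: lam_def[abs_def])

lemma lam_eq_iff:
  "\<lbrakk>a \<in> carrier A; x \<in> carrier A; y \<in> carrier A\<rbrakk> \<Longrightarrow> lam a x = lam a y \<longleftrightarrow> x = y"
  using inj_onD[OF bij_betw_imp_inj_on[OF lam_bij]] by blast

lemma lam_zero [simp]: "a \<in> carrier A \<Longrightarrow> lam a \<zero> = \<zero>"
  using lam_add[of a \<zero> \<zero>] by simp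

lemma lam_circle:
  assumes "a \<in> carrier A" "b \<in> carrier A" "x \<in> carrier A"
  shows "lam (a \<oplus> lam a b) x = lam a (lam b x)"
proof -
  have "a \<oplus> lam a b = a \<otimes> b \<oplus> a \<oplus> b"
    using assms by (simp add: lam_def mult_closed a_ac)
  then have "lam (a \<oplus> lam a b) x = (a \<otimes> (b \<otimes> x) \<oplus> a \<otimes> x \<oplus> b \<otimes> x) \<oplus> x"
    using assms by (simp add: lam_def brace_law)
  also have "\<dots> = lam a (lam b x)"
    using assms by (simp add: lam_def left_distrib mult_closed a_assoc)
  finally show ?thesis .
qed

lemma zero_lam [simp]: "x \<in> carrier A \<Longrightarrow> lam \<zero> x = x"
  using lam_circle[of \<zero> \<zero> x] by (simp add: lam_eq_iff)

abbreviation int_multiple :: "int \<Rightarrow> 'a \<Rightarrow> 'a"  (infixr \<open>\<star>\<close> 75) where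
  "k \<star> x \<equiv> add_pow A k x"

lemma lam_int_pow:
  assumes "a \<in> carrier A" "x \<in> carrier A"
  shows "lam a (k \<star> x) = k \<star> lam a x"
proof -
  have "lam a \<in> hom (add_monoid A) (add_monoid A)"
    using assms by (auto simp: hom_def lam_add)
  from hom_int_pow[OF this, of x k] show ?thesis
    using assms by (simp add: a_group add_pow_def)
qed

text \<open>\<open>y\<close> can be cancelled from \<open>a \<circ> y = y\<close> because it has a
  circle inverse. This is what later rules out unwanted values of \<open>lam\<close>.\<close>

lemma eq_zero_if_circle_eq:
  assumes "a \<in> carrier A" "y \<in> carrier A" "a \<oplus> lam a y = y"
  shows "a = \<zero>"
proof -
  \<comment> \<open>\<open>z\<close> is the circle inverse of \<open>y\<close>, found by
    surjectivity of \<open>lam y\<close>.\<close>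
  obtain z where z: "z \<in> carrier A" "lam y z = \<ominus> y"
    using lam_bij[OF assms(2)] assms(2) by (metis a_inv_closed bij_betw_iff_bijections)
  have "\<zero> = (a \<oplus> lam a y) \<oplus> lam (a \<oplus> lam a y) z"
    using assms z by (simp add: r_neg)
  also have "\<dots> = a \<oplus> lam a (y \<oplus> lam y z)"
    using assms(1,2) z(1) by (simp add: lam_circle lam_add a_assoc)
  also have "\<dots> = a"
    using assms(1,2) z by (simp add: r_neg)
  finally show ?thesis by simp
qed

end

section \<open>Sylow decomposition of the additive group\<close>

locale brace_4q = left_brace +
  fixes q :: nat and g :: 'a and K :: "'a set"
  assumes prime_q: "prime q" and q_gt_3: "q > 3" and order_A: "order A = 4 * q"
    and g_carrier [simp]: "g \<in> carrier A"
    and g_pow_eq_zero: "\<And>i::int. i \<star> g = \<zero> \<longleftrightarrow> int q dvd i"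
    and K_subgroup: "subgroup K (add_monoid A)"
    and card_K: "card K = 4"
    and K_pow: "\<And>k. k \<in> K \<Longrightarrow> 4 \<star> k = \<zero>"
    and decompose: "\<And>x. x \<in> carrier A \<Longrightarrow> \<exists>i::int. \<exists>k\<in>K. x = i \<star> g \<oplus> k"

text \<open>Sylow's theorem gives subgroups of orders \<open>q\<close> and 4. The sums of
  \<open>i \<star> g\<close> with \<open>0 \<le> i < q\<close> and an element of \<open>K\<close>
  are distinct, because multiplication by 4 kills \<open>K\<close> and is injective on multiples of
  \<open>g\<close>; by counting they fill the carrier.\<close>

lemma (in left_brace) brace_4q_exists:
  assumes q: "prime q" "q > 3" and ord: "order A = 4 * q"
  shows "\<exists>g K. brace_4q A q g K"
proof -
  have ordA: "order (add_monoid A) = 4 * q"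
    using ord by (simp add: order_def)
  have fin: "finite (carrier (add_monoid A))"
    using finite_carrier by simp
  have "\<exists>H. subgroup H (add_monoid A) \<and> card H = q ^ 1"
    using ordA by (intro sylow_thm[OF q(1) a_group _ fin, of 1 4]) simp
  then obtain H where H: "subgroup H (add_monoid A)" "card H = q" by auto
  have "\<exists>K. subgroup K (add_monoid A) \<and> card K = 2 ^ 2"
    using ordA by (intro sylow_thm[OF two_is_prime_nat a_group _ fin, of 2 q]) simp
  then obtain K where K: "subgroup K (add_monoid A)" "card K = 4" by auto
  have pow: "(int (card L)) \<star> x = \<zero>" if L: "subgroup L (add_monoid A)" "x \<in> L" for L x
  proof -
    interpret L: group "(add_monoid A)\<lparr>carrier := L\<rparr>"
      by (rule subgroup.subgroup_is_group[OF L(1) a_group])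
    have "x [^]\<^bsub>(add_monoid A)\<lparr>carrier := L\<rparr>\<^esub> card L = \<zero>"
      using L.pow_order_eq_1[of x] L by (simp add: order_def)
    then show ?thesis
      by (simp add: add_pow_def int_pow_int nat_pow_def)
  qed
  have KA: "K \<subseteq> carrier A" "finite K"
    using subgroup.subset[OF K(1)] K(2) by (auto intro: card_ge_0_finite)
  have "H \<noteq> {\<zero>}"
    using H(2) q(2) by auto
  then obtain g where g: "g \<in> H" "g \<noteq> \<zero>" "g \<in> carrier A"
    using subgroup.one_closed[OF H(1)] subgroup.subset[OF H(1)] by auto
  have g_iff: "i \<star> g = \<zero> \<longleftrightarrow> int q dvd i" for i :: int
  proof -
    have "add.ord g dvd q"
      using add.int_pow_eq_id[OF g(3), of "int q"] pow[OF H(1) g(1)] H(2) by simp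
    moreover have "add.ord g \<noteq> 1"
      using g add.ord_eq_1 by auto
    ultimately have "add.ord g = q"
      using q(1) by (auto simp: prime_nat_iff)
    then show ?thesis
      using add.int_pow_eq_id[OF g(3)] by simp
  qed
  let ?f = "\<lambda>(i, k). i \<star> g \<oplus> k"
  have inj: "inj_on ?f ({0..<int q} \<times> K)"
  proof (rule inj_onI, clarify)
    fix i j :: int and k l
    assume *: "i \<in> {0..<int q}" "j \<in> {0..<int q}" "k \<in> K" "l \<in> K"
      "i \<star> g \<oplus> k = j \<star> g \<oplus> l"
    then have kl: "k \<in> carrier A" "l \<in> carrier A" "4 \<star> k = \<zero>" "4 \<star> l = \<zero>"
      using KA pow[OF K(1)] K(2) by auto
    have "4 \<star> (i \<star> g \<oplus> k) = (4 * i) \<star> g" "4 \<star> (j \<star> g \<oplus> l) = (4 * j) \<star> g"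
      using kl g(3) by (simp_all add: add.int_pow_distrib add.int_pow_pow mult.commute)
    then have "(4 * i - 4 * j) \<star> g = \<zero>"
      using *(5) g(3) by (simp add: add.int_pow_diff r_neg)
    then have "int q dvd 4 * (i - j)"
      by (simp add: g_iff right_diff_distrib)
    moreover have "\<not> int q dvd 4"
      using q prime_dvd_mult_iff[of q 2 2] by (auto dest: dvd_imp_le simp: int_dvd_int_iff[of _ 4, simplified])
    ultimately have "int q dvd i - j"
      using q(1) prime_dvd_multD[of "int q" 4 "i - j"] by auto
    then have "i = j"
      using *(1,2) dvd_imp_le_int[of "i - j" "int q"] by (cases "i = j") auto
    then show "i = j \<and> k = l"
      using * kl g(3) by simp
  qed
  have "?f ` ({0..<int q} \<times> K) = carrier A"
  proof (rule card_subset_eq[OF finite_carrier])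
    show "?f ` ({0..<int q} \<times> K) \<subseteq> carrier A"
      using KA g by auto
    show "card (?f ` ({0..<int q} \<times> K)) = card (carrier A)"
      using ord K(2) by (simp add: card_image[OF inj] card_cartesian_product order_def)
  qed
  then have dec: "\<exists>i::int. \<exists>k\<in>K. x = i \<star> g \<oplus> k" if "x \<in> carrier A" for x
    using that by (fastforce simp: image_iff)
  have "brace_4q A q g K"
  proof (intro brace_4q.intro brace_4q_axioms.intro left_brace_axioms)
    show "4 \<star> k = \<zero>" if "k \<in> K" for k
      using pow[OF K(1) that] K(2) by simp
  qed (fact q ord g(3) g_iff K dec)+
  then show ?thesis by blast
qed

section \<open>Action on the two Sylow components\<close>

context brace_4q
begin

lemma K_carrier [simp]: "k \<in> K \<Longrightarrow> k \<in> carrier A"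
  using subgroup.mem_carrier[OF K_subgroup] by simp

lemma K_zero [simp]: "\<zero> \<in> K"
  using subgroup.one_closed[OF K_subgroup] by simp

lemma K_add [simp]: "\<lbrakk>k \<in> K; l \<in> K\<rbrakk> \<Longrightarrow> k \<oplus> l \<in> K"
  using subgroup.m_closed[OF K_subgroup] by simp

lemma finite_K: "finite K"
  using card_K by (auto intro: card_ge_0_finite)

lemma multiple_g_eq_iff: "i \<star> g = j \<star> g \<longleftrightarrow> [i = j] (mod int q)"
proof -
  have "i \<star> g = j \<star> g \<longleftrightarrow> (i - j) \<star> g = \<zero>"
    by (simp add: add.int_pow_diff add.inv_solve_right')
  then show ?thesis
    by (simp add: g_pow_eq_zero cong_iff_dvd_diff)
qed

lemma prime_dvd_4_multiple: "int q dvd 4 * i \<longleftrightarrow> int q dvd i"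
proof -
  have "\<not> q dvd 2"
    using q_gt_3 by (auto dest: dvd_imp_le)
  then have "\<not> int q dvd 2"
    using int_dvd_int_iff[of q 2] by simp
  moreover have "int q dvd 4 * i \<longleftrightarrow> int q dvd 2 * (2 * i)"
    by simp
  ultimately show ?thesis
    using prime_q by (subst (asm) prime_dvd_mult_iff) (simp_all add: prime_dvd_mult_iff)
qed

text \<open>Bezout for \<open>q\<close> and 4 annihilates the part in \<open>K\<close>. With
  \<open>four_torsion\<close> this describes both components by addition alone, so every
  \<open>lam a\<close> preserves them.\<close>

lemma q_torsion:
  assumes "x \<in> carrier A" "int q \<star> x = \<zero>"
  shows "\<exists>i::int. x = i \<star> g"
proof -
  obtain i k where x: "x = i \<star> g \<oplus> k" and k: "k \<in> K"
    using decompose[OF assms(1)] by blast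
  have "int q \<star> (i \<star> g) = \<zero>"
    by (simp add: add.int_pow_pow g_pow_eq_zero)
  then have qk: "int q \<star> k = \<zero>"
    using assms(2) k by (simp add: x add.int_pow_distrib)
  have "coprime (int q) 4"
    using prime_q prime_dvd_4_multiple[of 1] q_gt_3
    by (intro prime_imp_coprime) (auto dest: zdvd_imp_le)
  then obtain u v where uv: "u * int q + v * 4 = 1"
    using bezout_int[of "int q" 4] by auto
  have "k = (int q * u + 4 * v) \<star> k"
    using uv k by (simp add: mult.commute)
  also have "\<dots> = \<zero>"
    using k qk K_pow by (simp add: add.int_pow_mult flip: add.int_pow_pow)
  finally show ?thesis
    using x k by auto
qed

lemma four_torsion:
  assumes "x \<in> carrier A" "4 \<star> x = \<zero>"
  shows "x \<in> K"
proof -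
  obtain i k where x: "x = i \<star> g \<oplus> k" and k: "k \<in> K"
    using decompose[OF assms(1)] by blast
  have "(4 * i) \<star> g = \<zero>"
    using assms(2) k K_pow[OF k]
    by (simp add: x add.int_pow_distrib add.int_pow_pow mult.commute[of i])
  then have "i \<star> g = \<zero>"
    by (simp add: g_pow_eq_zero prime_dvd_4_multiple)
  then show ?thesis
    using x k by simp
qed

lemma lam_K [simp]: "\<lbrakk>a \<in> carrier A; k \<in> K\<rbrakk> \<Longrightarrow> lam a k \<in> K"
  by (rule four_torsion) (simp_all add: K_pow flip: lam_int_pow)

lemma lam_g: "a \<in> carrier A \<Longrightarrow> \<exists>m::int. lam a g = m \<star> g"
  using g_pow_eq_zero[of "int q"] by (intro q_torsion) (simp_all flip: lam_int_pow)

text \<open>If \<open>x = i \<star> g\<close> multiplied \<open>g\<close> by some \<open>m\<close>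
  other than 1 modulo \<open>q\<close>, then \<open>x \<circ> y = y\<close> would be solvable among
  the multiples of \<open>g\<close>, forcing \<open>x = \<zero>\<close>.\<close>

lemma lam_multiple_g_g: "lam (i \<star> g) g = g"
proof (cases "i \<star> g = \<zero>")
  case False
  let ?x = "i \<star> g"
  obtain m where m: "lam ?x g = m \<star> g"
    using lam_g[of ?x] by auto
  show ?thesis
  proof (rule ccontr)
    assume "lam ?x g \<noteq> g"
    then have "\<not> int q dvd 1 - m"
      using multiple_g_eq_iff[of m 1] by (simp add: m cong_iff_dvd_diff dvd_diff_commute)
    then have "coprime (1 - m) (int q)"
      using prime_q by (metis coprime_commute prime_imp_coprime prime_nat_int_transfer)
    then obtain u where u: "[(1 - m) * u = 1] (mod int q)"
      using cong_solve_coprime_int by blast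
    \<comment> \<open>With \<open>u\<close> inverse to \<open>1 - m\<close>, the number
      \<open>t = u * i\<close> solves \<open>i + m * t = t\<close> modulo \<open>q\<close>.\<close>
    let ?y = "(u * i) \<star> g"
    have "?x \<oplus> lam ?x ?y = (i + m * (u * i)) \<star> g"
      by (simp add: lam_int_pow m add.int_pow_mult add.int_pow_pow)
    also have "\<dots> = ?y"
      using cong_scalar_right[OF cong_sym[OF u], of i]
      by (simp add: multiple_g_eq_iff cong_iff_dvd_diff algebra_simps)
    finally have "?x = \<zero>"
      by (intro eq_zero_if_circle_eq[of ?x ?y]) simp_all
    with False show False by blast
  qed
qed simp

text \<open>On multiples of \<open>g\<close> the circle product is addition, so the
  \<open>q\<close>-th iterate of \<open>lam (i \<star> g)\<close> is the identity; a map permitting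
  this on the small set \<open>K\<close> fixes it pointwise.\<close>

lemma lam_multiple_g:
  assumes "x \<in> carrier A"
  shows "lam (i \<star> g) x = x"
proof -
  have pow: "(lam (i \<star> g) ^^ n) y = lam ((int n * i) \<star> g) y" if y: "y \<in> carrier A" for n y
  proof (induction n)
    case (Suc n)
    have "(i + int n * i) \<star> g = i \<star> g \<oplus> lam (i \<star> g) ((int n * i) \<star> g)"
      by (simp add: lam_int_pow lam_multiple_g_g add.int_pow_mult)
    then show ?case
      using Suc y by (simp add: lam_circle distrib_right)
  qed (use y in \<open>simp add: add_pow_def\<close>)
  obtain j k where x: "x = j \<star> g \<oplus> k" and k: "k \<in> K"
    using decompose[OF assms] by blast
  have "(int q * i) \<star> g = \<zero>"
    by (simp add: g_pow_eq_zero)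
  then have "(lam (i \<star> g) ^^ q) k = k"
    using k by (simp add: pow)
  \<comment> \<open>\<open>q > 3\<close> alone leaves \<open>q = 4\<close> open, where
    \<open>card K < q\<close> would fail.\<close>
  moreover have "q \<noteq> 4"
    using prime_q by auto
  then have "card K < q"
    using q_gt_3 by (simp add: card_K)
  moreover have "lam (i \<star> g) ` K \<subseteq> K"
    by auto
  ultimately have "lam (i \<star> g) k = k"
    using fixed_if_funpow_prime_fixed[OF prime_q finite_K] k by blast
  then show ?thesis
    using k by (simp add: x lam_add lam_int_pow lam_multiple_g_g)
qed

lemma lam_decompose:
  assumes "k \<in> K" "x \<in> carrier A"
  shows "lam (i \<star> g \<oplus> k) x = lam k x"
  using lam_circle[of "i \<star> g" k x] assms by (simp add: lam_multiple_g)

section \<open>Braces of order 4\<close>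

text \<open>\<open>e\<close> and \<open>f\<close> play the roles of 1 and 2 in the model with parameters \<open>v\<close>, \<open>w\<close>.\<close>

definition basis :: "bool \<Rightarrow> bool \<Rightarrow> 'a \<Rightarrow> 'a \<Rightarrow> bool" where
  "basis v w e f \<longleftrightarrow>
    e \<in> K \<and> f \<in> K \<and> e \<noteq> \<zero> \<and> f \<noteq> \<zero> \<and> e \<noteq> f \<and> e \<oplus> f \<noteq> \<zero> \<and>
    f \<oplus> f = \<zero> \<and> e \<oplus> e = (if v then \<zero> else f) \<and>
    lam f e = e \<and> lam f f = f \<and> lam e f = f \<and> lam e e = (if w then e \<oplus> f else e)"

lemma K_eq:
  assumes "e \<in> K" "f \<in> K" "e \<noteq> \<zero>" "f \<noteq> \<zero>" "e \<noteq> f" "e \<oplus> f \<noteq> \<zero>"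
  shows "K = {\<zero>, e, f, e \<oplus> f}"
proof (rule sym, rule card_subset_eq[OF finite_K])
  have "e \<oplus> f \<noteq> e" "e \<oplus> f \<noteq> f"
    using assms by simp_all
  then show "card {\<zero>, e, f, e \<oplus> f} = card K"
    using assms by (simp add: card_K eq_commute)
qed (use assms in simp)

lemma four_multiple: "k \<in> K \<Longrightarrow> k \<oplus> k \<oplus> (k \<oplus> k) = \<zero>"
  using K_pow[of k] add.int_pow_mult[of k 2 2] add.int_pow_mult[of k 1 1] by simp

text \<open>As \<open>a \<oplus> a = \<zero>\<close>, equality would give
  \<open>a \<circ> y = y\<close>, contrary to cancellation in the circle group.\<close>

lemma lam_ne_add:
  assumes "a \<in> K" "y \<in> K" "a \<noteq> \<zero>" "a \<oplus> a = \<zero>"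
  shows "lam a y \<noteq> y \<oplus> a"
proof
  assume "lam a y = y \<oplus> a"
  then have "a \<oplus> lam a y = y"
    using assms by (simp add: a_lcomm[of a y a])
  then have "a = \<zero>"
    using assms by (intro eq_zero_if_circle_eq[of a y]) simp_all
  with assms(3) show False by simp
qed

text \<open>An automorphism of a cyclic group of order 4 sends \<open>e\<close> to \<open>e\<close>
  or to its negative \<open>e \<oplus> f\<close>, and fixes the involution \<open>f\<close>. Since
  \<open>lam_ne_add\<close> excludes \<open>lam f e = e \<oplus> f\<close>, only
  \<open>lam e e\<close> remains free, and \<open>w\<close> records it.\<close>

lemma basis_cyclic:
  assumes e: "e \<in> K" "e \<oplus> e \<noteq> \<zero>"
  shows "\<exists>w. basis False w e (e \<oplus> e)"
proof -
  define f where "f = e \<oplus> e"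
  have f: "f \<in> K" "f \<noteq> \<zero>" "f \<oplus> f = \<zero>"
    using e four_multiple by (simp_all add: f_def)
  have ne: "e \<noteq> \<zero>" "e \<noteq> f" "e \<oplus> f \<noteq> \<zero>"
  proof -
    show "e \<noteq> \<zero>" using e(2) by auto
    then show "e \<noteq> f" using e(1) by (simp add: f_def)
    show "e \<oplus> f \<noteq> \<zero>"
    proof
      assume *: "e \<oplus> f = \<zero>"
      have "e \<oplus> (e \<oplus> f) = f \<oplus> f"
        using e(1) by (simp add: f_def a_assoc)
      then show False
        using * f(3) e(1) \<open>e \<noteq> \<zero>\<close> by simp
    qed
  qed
  note K = K_eq[OF e(1) f(1) ne(1) f(2) ne(2,3)]
  have lam_e: "lam x e = e \<or> lam x e = e \<oplus> f" if "x \<in> K" for x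
  proof -
    have "lam x f = lam x e \<oplus> lam x e"
      using that e(1) by (simp add: f_def lam_add)
    moreover have "lam x f \<noteq> \<zero>"
      using that f lam_eq_iff[of x f \<zero>] by simp
    ultimately have "lam x e \<oplus> lam x e \<noteq> \<zero>" by simp
    moreover have "lam x e \<in> {\<zero>, e, f, e \<oplus> f}"
      using that e(1) K by (metis lam_K K_carrier)
    ultimately show ?thesis
      using f(3) by auto
  qed
  have ff: "e \<oplus> f \<oplus> (e \<oplus> f) = f"
    using e(1) f(1) f(3) by (simp add: a_ac) (simp add: f_def a_ac)
  have lam_f: "lam x f = f" if "x \<in> K" for x
  proof -
    have "lam x f = lam x e \<oplus> lam x e"
      using that e(1) by (simp add: f_def lam_add)
    then show ?thesis
      using lam_e[OF that] ff by (auto simp: f_def)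
  qed
  have "lam f e = e"
    using lam_e[OF f(1)] lam_ne_add[OF f(1) e(1) f(2,3)] by auto
  then have "basis False (lam e e = e \<oplus> f) e f"
    using e(1) f ne lam_f lam_e[OF e(1)] by (auto simp: basis_def simp flip: f_def)
  then show ?thesis
    unfolding f_def by blast
qed

text \<open>If \<open>K\<close> acts trivially on itself, any two distinct nonzero elements serve.
  Otherwise an element \<open>e\<close> acting nontrivially moves itself, and
  \<open>f = e \<circ> e\<close> completes the basis.\<close>

lemma basis_elementary:
  assumes two: "\<And>k. k \<in> K \<Longrightarrow> k \<oplus> k = \<zero>"
  shows "\<exists>w e f. basis True w e f"
proof -
  have ne: "e \<oplus> f \<noteq> \<zero>" if "e \<in> K" "f \<in> K" "e \<noteq> f" for e f
  proof
    assume "e \<oplus> f = \<zero>"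
    then have "e \<oplus> f \<oplus> f = f" using that by simp
    then show False using that two by (simp add: a_assoc)
  qed
  have cancel: "x \<oplus> (x \<oplus> y) = y" if "x \<in> K" "y \<in> K" for x y
    using that two[of x] by (simp flip: a_assoc)
  show ?thesis
  proof (cases "\<exists>p\<in>K. \<exists>y\<in>K. lam p y \<noteq> y")
    case False
    have "\<not> K \<subseteq> {\<zero>}" using card_mono[of "{\<zero>}" K] by (auto simp: card_K)
    then obtain e where e: "e \<in> K" "e \<noteq> \<zero>" by auto
    have "\<not> K \<subseteq> {\<zero>, e}" using card_mono[of "{\<zero>, e}" K] e by (auto simp: card_K)
    then obtain f where f: "f \<in> K" "f \<noteq> \<zero>" "f \<noteq> e" by auto
    have "basis True False e f"
      using e f ne two False by (auto simp: basis_def)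
    then show ?thesis by blast
  next
    case True
    then obtain e y where e: "e \<in> K" and y: "y \<in> K" "lam e y \<noteq> y" by auto
    have e0: "e \<noteq> \<zero>" using y by auto
    have nofix: "lam e z \<noteq> z \<oplus> e" if "z \<in> K" for z
      using lam_ne_add[OF e that e0 two[OF e]] .
    \<comment> \<open>If \<open>e\<close> were fixed, the moved \<open>y\<close> could only go to
      \<open>e \<oplus> y\<close>, which \<open>nofix\<close> forbids.\<close>
    have moved: "lam e e \<noteq> e"
    proof
      assume *: "lam e e = e"
      have "y \<noteq> \<zero>" "y \<noteq> e" using y e * by auto
      then have K: "K = {\<zero>, e, y, e \<oplus> y}"
        using e y e0 ne by (intro K_eq) auto
      have "lam e y \<noteq> \<zero>" "lam e y \<noteq> e"
        using lam_eq_iff[of e y \<zero>] lam_eq_iff[of e y e] e y \<open>y \<noteq> \<zero>\<close> \<open>y \<noteq> e\<close> * by auto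
      moreover have "lam e y \<noteq> e \<oplus> y"
        using nofix[OF y(1)] e y by (simp add: a_comm)
      moreover have "lam e y \<in> {\<zero>, e, y, e \<oplus> y}"
        using e y(1) K by (metis lam_K K_carrier)
      ultimately show False using y(2) by blast
    qed
    define f where "f = e \<oplus> lam e e"
    have f: "f \<in> K" "lam e e = e \<oplus> f"
      using e cancel by (simp_all add: f_def)
    have "lam e e \<noteq> \<zero>"
      using lam_eq_iff[of e e \<zero>] e e0 by simp
    then have f': "f \<noteq> \<zero>" "f \<noteq> e"
      using ne[OF e _ moved[symmetric]] e by (auto simp: f_def)
    note K = K_eq[OF e f(1) e0 f'(1) f'(2)[symmetric] ne[OF e f(1) f'(2)[symmetric]]]
    \<comment> \<open>Injectivity excludes \<open>\<zero>\<close> and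
      \<open>e \<oplus> f = lam e e\<close>; the value \<open>e\<close> would make
      \<open>lam e\<close> translate \<open>e \<oplus> f\<close> by \<open>e\<close>.\<close>
    have lef: "lam e f = f"
    proof -
      have "lam e f \<noteq> \<zero>"
        using lam_eq_iff[of e f \<zero>] e f f' by simp
      moreover have "lam e f \<noteq> e \<oplus> f"
        using lam_eq_iff[of e e f] e f f' by auto
      moreover have "lam e f \<noteq> e"
      proof
        assume "lam e f = e"
        then have "lam e (e \<oplus> f) = e \<oplus> f \<oplus> e"
          using e f by (simp add: lam_add)
        then show False
          using nofix[of "e \<oplus> f"] e f by simp
      qed
      moreover have "lam e f \<in> {\<zero>, e, f, e \<oplus> f}"
        using e f(1) K by (metis lam_K K_carrier)
      ultimately show ?thesis by blast
    qed
    have lam_f: "lam f x = lam e (lam e x)" if "x \<in> K" for x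
      using lam_circle[of e e x] that e by (simp add: f_def)
    have "e \<oplus> f \<oplus> f = e"
      using e f(1) two[OF f(1)] by (simp add: a_assoc)
    then have "lam f e = e"
      using e f by (simp add: lam_f lam_add lef)
    then have "basis True True e f"
      using e f e0 f' ne two lef lam_f by (auto simp: basis_def)
    then show ?thesis by blast
  qed
qed

lemma basis_exists: "\<exists>v w e f. basis v w e f"
  using basis_cyclic basis_elementary by metis

lemma basis_lam_add:
  assumes "basis v w e f" "x \<in> carrier A"
  shows "lam (e \<oplus> f) x = lam f (lam e x)"
proof -
  have "f \<oplus> lam f e = e \<oplus> f"
    using assms by (simp add: basis_def a_comm)
  then show ?thesis
    using lam_circle[of f e x] assms by (simp add: basis_def)
qed

text \<open>This realises the exchange of 1 and 3 in the model; it will serve to change the sign of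
  \<open>c\<close> when \<open>d\<close> is -1.\<close>

lemma basis_change:
  assumes b: "basis v w e f"
  shows "basis v w (e \<oplus> f) f"
proof -
  have c [simp]: "e \<in> carrier A" "f \<in> carrier A" and ef: "e \<in> K" "f \<in> K"
    using b by (auto simp: basis_def)
  have ff: "f \<oplus> f = \<zero>" and ff': "x \<oplus> f \<oplus> f = x" if "x \<in> carrier A" for x
    using b that by (simp_all add: basis_def a_assoc)
  have "e \<oplus> f \<oplus> (e \<oplus> f) = e \<oplus> e \<oplus> (f \<oplus> f)"
    by (simp add: a_ac)
  then have dbl: "e \<oplus> f \<oplus> (e \<oplus> f) = e \<oplus> e"
    using ff[of f] by simp
  show ?thesis
    using b ef unfolding basis_def
    by (simp add: basis_lam_add[OF b] lam_add dbl ff')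
qed

lemma basis_swap: "basis True False e f \<Longrightarrow> basis True False f e"
  by (auto simp: basis_def a_comm)

text \<open>Lambda turns the circle squares \<open>f \<circ> f = \<zero>\<close> and
  \<open>e \<circ> e\<close>, which is \<open>f\<close> or \<open>\<zero>\<close>, into the
  relations on \<open>d\<close> and \<open>c\<close>.\<close>

lemma basis_admissible:
  assumes b: "basis v w e f" and c: "lam e g = c \<star> g" and d: "lam f g = d \<star> g"
  shows "admissible (int q) v w c d"
proof -
  have car [simp]: "e \<in> carrier A" "f \<in> carrier A"
    using b by (auto simp: basis_def)
  have "(d * d) \<star> g = lam f (lam f g)" "(c * c) \<star> g = lam e (lam e g)"
    by (simp_all add: c d lam_int_pow add.int_pow_pow)
  then have dc: "(d * d) \<star> g = lam (f \<oplus> lam f f) g" "(c * c) \<star> g = lam (e \<oplus> lam e e) g"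
    by (simp_all add: lam_circle)
  have "f \<oplus> lam f f = \<zero>" 
    using b by (simp add: basis_def)
  then have 1: "(d * d) \<star> g = 1 \<star> g"
    using dc(1) by simp
  have "e \<oplus> lam e e = (if v = w then f else \<zero>)"
    using b by (auto simp: basis_def simp flip: a_assoc split: if_splits)
  then have 2: "(c * c) \<star> g = (if v = w then d else 1) \<star> g"
    using dc(2) d by simp
  show ?thesis
    using 1 2 unfolding multiple_g_eq_iff admissible_def power2_eq_square by blast
qed

end

section \<open>Characters and the classification\<close>

lemma cong_eq_or_minus_if_squares_cong:
  fixes x y p :: int
  assumes "prime p" "[x\<^sup>2 = y\<^sup>2] (mod p)"
  shows "[x = y] (mod p) \<or> [x = - y] (mod p)"
proof -
  have "p dvd (x - y) * (x + y)"
    using assms(2) by (simp add: cong_iff_dvd_diff power2_eq_square algebra_simps)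
  then show ?thesis
    using assms(1) by (simp add: prime_dvd_mult_iff cong_iff_dvd_diff)
qed

text \<open>Euler's criterion at -1: the parity of \<open>(q - 1) div 2\<close> decides, because 1
  and -1 are distinct modulo \<open>q\<close>.\<close>

lemma minus_one_square_iff:
  assumes q: "prime q" "q > 3"
  shows "(\<exists>s. [s\<^sup>2 = - 1] (mod int q)) \<longleftrightarrow> 4 dvd q - 1"
proof -
  have m1: "\<not> [- 1 = 1] (mod int q)" "\<not> [1 = - 1] (mod int q)" "\<not> [- 1 = 0] (mod int q)"
    using q(2) by (auto simp: cong_iff_dvd_diff dest: zdvd_imp_le)
  have "odd q"
    using q by (intro prime_odd_nat) auto
  then have div: "4 dvd q - 1 \<longleftrightarrow> even ((q - 1) div 2)"
    using q(2) by presburger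
  have "[Legendre (- 1) (int q) = (- 1) ^ ((q - 1) div 2)] (mod int q)"
    using q by (intro euler_criterion) auto
  moreover have "Legendre (- 1) (int q) = (if \<exists>s. [s\<^sup>2 = - 1] (mod int q) then 1 else - 1)"
    using m1(3) by (simp add: Legendre_def QuadRes_def)
  ultimately show ?thesis
    unfolding div using m1(1,2) by (cases "even ((q - 1) div 2)") (auto split: if_splits)
qed

text \<open>A basis is adjusted until its character values are representatives. If \<open>d\<close>
  is 1, then \<open>c\<close> is already 1 or -1; if \<open>d\<close> is -1, passing from
  \<open>e\<close> to \<open>e \<oplus> f\<close> negates \<open>c\<close>.\<close>

lemma (in brace_4q) parameters_exist:
  assumes S: "\<And>c. [c\<^sup>2 = - 1] (mod int q) \<Longrightarrow> \<exists>s\<in>S. [s\<^sup>2 = - 1] (mod int q)"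
  shows "\<exists>v w c d e f. (v, w, c, d) \<in> parameters S \<and> basis v w e f \<and>
    lam e g = c \<star> g \<and> lam f g = d \<star> g"
proof -
  obtain v w e f where b: "basis v w e f"
    using basis_exists by blast
  then have car [simp]: "e \<in> carrier A" "f \<in> carrier A"
    by (auto simp: basis_def)
  obtain c d where c: "lam e g = c \<star> g" and d: "lam f g = d \<star> g"
    using lam_g[OF car(1)] lam_g[OF car(2)] by blast
  have "admissible (int q) v w c d"
    by (rule basis_admissible[OF b c d])
  then have d2: "[d\<^sup>2 = 1\<^sup>2] (mod int q)" and c2: "[c\<^sup>2 = (if v = w then d else 1)] (mod int q)"
    by (simp_all add: admissible_def)
  have sum: "lam (e \<oplus> f) g = (- c) \<star> g" if "[d = - 1] (mod int q)"
  proof -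
    have "lam (e \<oplus> f) g = (d * c) \<star> g"
      using basis_lam_add[OF b, of g] by (simp add: c d lam_int_pow add.int_pow_pow)
    also have "\<dots> = (- c) \<star> g"
      using cong_scalar_right[OF that, of c] by (simp add: multiple_g_eq_iff)
    finally show ?thesis .
  qed
  have prm: "prime (int q)"
    using prime_q by simp
  consider (plus) "[d = 1] (mod int q)" | (minus) "[d = - 1] (mod int q)"
    using cong_eq_or_minus_if_squares_cong[OF prm d2] by auto
  then show ?thesis
  proof cases
    case plus
    have "[c\<^sup>2 = 1\<^sup>2] (mod int q)"
      using c2 plus cong_trans by (auto split: if_splits)
    from cong_eq_or_minus_if_squares_cong[OF prm this]
    obtain c' :: int where c': "c' \<in> {1, - 1}" "[c = c'] (mod int q)"
      by blast
    then have "lam e g = c' \<star> g" "lam f g = 1 \<star> g"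
      using c d plus by (auto simp: multiple_g_eq_iff simp del: add.int_pow_1)
    moreover have "(v, w, c', 1) \<in> parameters S"
      using c'(1) by (auto simp: parameters_def)
    ultimately show ?thesis
      using b by blast
  next
    case minus
    then have f: "lam f g = (- 1) \<star> g"
      using d by (simp add: multiple_g_eq_iff)
    show ?thesis
    proof (cases "v = w")
      case True
      then have "[c\<^sup>2 = - 1] (mod int q)"
        using c2 minus cong_trans by auto
      then obtain s where s: "s \<in> S" "[s\<^sup>2 = - 1] (mod int q)"
        using S by blast
      then have "[c\<^sup>2 = s\<^sup>2] (mod int q)"
        using \<open>[c\<^sup>2 = - 1] (mod int q)\<close> cong_trans cong_sym by blast
      \<comment> \<open>The root \<open>c\<close> is \<open>s\<close> or \<open>- s\<close> modulo
        \<open>q\<close>; in the second case \<open>e \<oplus> f\<close> replaces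
        \<open>e\<close>.\<close>
      then have "lam e g = s \<star> g \<or> lam (e \<oplus> f) g = s \<star> g"
        using cong_eq_or_minus_if_squares_cong[OF prm, of c s] cong_minus_minus_iff[of "- c" s "int q"]
        by (auto simp: c sum[OF minus] multiple_g_eq_iff)
      moreover have "(v, w, s, - 1) \<in> parameters S"
        using True s(1) by (simp add: parameters_def)
      ultimately show ?thesis
        using b basis_change[OF b] f by blast
    next
      case False
      then have "[c\<^sup>2 = 1\<^sup>2] (mod int q)"
        using c2 by simp
      from cong_eq_or_minus_if_squares_cong[OF prm this]
      have "[c = 1] (mod int q) \<or> [- c = 1] (mod int q)"
        using cong_minus_minus_iff[of "- c" 1 "int q"] by simp
      then have "\<exists>e. basis v w e f \<and> lam e g = 1 \<star> g"
        using b basis_change[OF b] c sum[OF minus] by (auto simp: multiple_g_eq_iff simp del: add.int_pow_1)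
      then obtain e' where e': "basis v w e' f" "lam e' g = 1 \<star> g" by blast
      show ?thesis
      proof (cases v)
        case True
        \<comment> \<open>Here the brace on \<open>K\<close> is trivial and elementary, so the basis
          may be swapped, turning the values \<open>(1, - 1)\<close> into the representative
          \<open>(- 1, 1)\<close>.\<close>
        then have "basis v w f e'"
          using False e'(1) basis_swap by simp
        moreover have "(v, w, - 1, 1) \<in> parameters S"
          by (simp add: parameters_def)
        ultimately show ?thesis
          using e'(2) f by blast
      next
        assume "\<not> v"
        then have "(v, w, 1, - 1) \<in> parameters S"
          using False by (simp add: parameters_def)
        then show ?thesis
          using e' f by blast
      qed
    qed
  qed
qed

context brace_4q
begin

text \<open>For \<open>p < 4\<close> the two conditions read off the binary digits of
  \<open>p\<close>, so that 3 becomes \<open>e \<oplus> f\<close>.\<close>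

definition point :: "'a \<Rightarrow> 'a \<Rightarrow> nat \<Rightarrow> 'a" where
  "point e f p = (if odd p then e else \<zero>) \<oplus> (if 2 \<le> p then f else \<zero>)"

lemma model_isomorphic:
  assumes b: "basis v w e f" and c: "lam e g = c \<star> g" and d: "lam f g = d \<star> g"
  shows "brace_isomorphic (model (int q) v w c d) A"
proof -
  let ?M = "model (int q) v w c d" and ?\<pi> = "point e f"
  let ?h = "\<lambda>(x, p). x \<star> g \<oplus> ?\<pi> p"
  have K [simp]: "e \<in> K" "f \<in> K" and ff: "f \<oplus> f = \<zero>"
    using b by (auto simp: basis_def)
  have \<pi>: "?\<pi> 0 = \<zero>" "?\<pi> 1 = e" "?\<pi> (Suc 0) = e" "?\<pi> 2 = f" "?\<pi> (Suc (Suc 0)) = f" "?\<pi> 3 = e \<oplus> f"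
    by (simp_all add: point_def)
  have \<pi>K [simp]: "?\<pi> p \<in> K" for p
    by (simp add: point_def)
  have f_cancel: "f \<oplus> (f \<oplus> x) = x" if "x \<in> carrier A" for x
    using that ff by (simp flip: a_assoc)
  have e_add: "e \<oplus> (e \<oplus> x) = (if v then x else f \<oplus> x)" "e \<oplus> e = (if v then \<zero> else f)"
    if "x \<in> carrier A" for x
    using that b by (simp_all add: basis_def flip: a_assoc)
  have f_e: "f \<oplus> e = e \<oplus> f" "f \<oplus> (e \<oplus> x) = e \<oplus> (f \<oplus> x)" if "x \<in> carrier A" for x
    using that by (simp_all add: a_comm a_lcomm)
  note ef = f_cancel e_add f_e ff a_assoc
  have "\<forall>p<4. \<forall>r<4. ?\<pi> (padd v p r) = ?\<pi> p \<oplus> ?\<pi> r"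
    by (cases v) (simp_all add: all_less_4 padd_def twist_def \<pi> ef e_add(2)[OF zero_closed] f_e(1)[OF zero_closed])
  then have \<pi>_padd: "?\<pi> (padd v p r) = ?\<pi> p \<oplus> ?\<pi> r" if "p < 4" "r < 4" for p r
    using that by blast
  have lam_sum: "lam (e \<oplus> f) x = lam f (lam e x)" if "x \<in> carrier A" for x
    by (rule basis_lam_add[OF b that])
  have lam_ef: "lam f e = e" "lam f f = f" "lam e f = f" "lam e e = (if w then e \<oplus> f else e)"
    using b by (auto simp: basis_def)
  have "\<forall>p<4. \<forall>r<4. lam (?\<pi> p) (?\<pi> r) = ?\<pi> (twist w p r) \<oplus> ?\<pi> r"
    by (cases w) (simp_all add: all_less_4 twist_def \<pi> lam_sum lam_ef lam_add ef f_e(1)[OF zero_closed])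
  then have lam_\<pi>: "lam (?\<pi> p) (?\<pi> r) = ?\<pi> (twist w p r) \<oplus> ?\<pi> r" if "p < 4" "r < 4" for p r
    using that by blast
  have "\<forall>p<4. lam (?\<pi> p) g = character c d p \<star> g"
    by (simp add: all_less_4 \<pi> character_def numeral_3_eq_3[symmetric] lam_sum c d lam_int_pow
        add.int_pow_pow mult.commute)
  then have lam_g: "lam (?\<pi> p) g = character c d p \<star> g" if "p < 4" for p
    using that by blast
  have mod_g: "(x mod int q) \<star> g = x \<star> g" for x
    by (simp add: multiple_g_eq_iff)
  have "?h ` carrier ?M = carrier A"
  proof (intro equalityI subsetI)
    fix x assume "x \<in> carrier A"
    then obtain i k where x: "x = i \<star> g \<oplus> k" and k: "k \<in> K"
      using decompose by blast
    have "K = {\<zero>, e, f, e \<oplus> f}"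
      using b by (intro K_eq) (auto simp: basis_def)
    then have "k \<in> ?\<pi> ` {0, 1, 2, 3}"
      using k by (simp add: \<pi>)
    then obtain p where "p \<in> {0, 1, 2, 3}" "k = ?\<pi> p" by blast
    then have "p < 4" "k = ?\<pi> p" by auto
    then have "(i mod int q, p) \<in> carrier ?M" "x = ?h (i mod int q, p)"
      using q_gt_3 by (simp_all add: model_def x mod_g)
    then show "x \<in> ?h ` carrier ?M" by blast
  qed auto
  moreover have "inj_on ?h (carrier ?M)"
  proof (rule eq_card_imp_inj_on)
    show "finite (carrier ?M)"
      by (simp add: model_def)
    show "card (?h ` carrier ?M) = card (carrier ?M)"
      using calculation order_A order_model[of q v w c d] by (simp add: order_def)
  qed
  ultimately have "bij_betw ?h (carrier ?M) (carrier A)"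
    by (simp add: bij_betw_def)
  moreover have "?h (a \<oplus>\<^bsub>?M\<^esub> b) = ?h a \<oplus> ?h b \<and> ?h (a \<otimes>\<^bsub>?M\<^esub> b) = ?h a \<otimes> ?h b"
    if ab: "a \<in> carrier ?M" "b \<in> carrier ?M" for a b
  proof -
    obtain x p y r where [simp]: "a = (x, p)" "b = (y, r)"
      by (metis surj_pair)
    have pr: "p < 4" "r < 4"
      using ab by (auto simp: model_def)
    have "?h (a \<oplus>\<^bsub>?M\<^esub> b) = ?h a \<oplus> ?h b"
      using pr by (simp add: model_def mod_g \<pi>_padd add.int_pow_mult a_ac)
    \<comment> \<open>Adding \<open>?h b\<close> turns the product into \<open>lam\<close>, for
      which only the part of \<open>?h a\<close> in \<open>K\<close> matters; it is cancelled
      afterwards.\<close>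
    moreover have "?h a \<otimes> ?h b \<oplus> ?h b = ?h (a \<otimes>\<^bsub>?M\<^esub> b) \<oplus> ?h b"
    proof -
      have "?h a \<otimes> ?h b \<oplus> ?h b = lam (?\<pi> p) (y \<star> g \<oplus> ?\<pi> r)"
        using lam_decompose[of "?\<pi> p" "y \<star> g \<oplus> ?\<pi> r" x] by (simp add: lam_def)
      also have "\<dots> = (character c d p * y) \<star> g \<oplus> (?\<pi> (twist w p r) \<oplus> ?\<pi> r)"
        using pr by (simp add: lam_add lam_int_pow lam_g lam_\<pi> add.int_pow_pow)
      also have "(character c d p * y) \<star> g = ((character c d p - 1) * y) \<star> g \<oplus> y \<star> g"
        by (simp add: left_diff_distrib flip: add.int_pow_mult)
      finally show ?thesis
        by (simp add: model_def mod_g a_ac)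
    qed
    ultimately show ?thesis
      by (simp add: mult_closed model_def)
  qed
  ultimately have "?h \<in> brace_iso ?M A"
    by (simp add: brace_iso_def)
  then show ?thesis
    by (auto simp: brace_isomorphic_def)
qed

lemma isomorphic_model_exists:
  assumes "\<And>c. [c\<^sup>2 = - 1] (mod int q) \<Longrightarrow> \<exists>s\<in>S. [s\<^sup>2 = - 1] (mod int q)"
  shows "\<exists>v w c d. (v, w, c, d) \<in> parameters S \<and> brace_isomorphic (model (int q) v w c d) A"
proof -
  obtain v w c d e f where "(v, w, c, d) \<in> parameters S" "basis v w e f"
    "lam e g = c \<star> g" "lam f g = d \<star> g"
    using parameters_exist[of S] assms by blast
  then show ?thesis
    using model_isomorphic by blast
qed

end

theorem corollary4:
  fixes q :: nat
  assumes "prime q" and "q > 3"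
  shows "num_braces (4 * q) = (if \<not> 4 dvd q - 1 then 9 else 11)"
proof -
  \<comment> \<open>\<open>S\<close> holds one root of -1 if there is any; the other root is its
    negative, and a change of basis absorbs the sign.\<close>
  obtain S :: "int set" and r where S: "\<And>s. s \<in> S \<Longrightarrow> [s\<^sup>2 = - 1] (mod int q)" "S \<subseteq> {r}"
    "\<And>c. [c\<^sup>2 = - 1] (mod int q) \<Longrightarrow> \<exists>s\<in>S. [s\<^sup>2 = - 1] (mod int q)"
    "card (parameters S) = (if \<not> 4 dvd q - 1 then 9 else 11)"
  proof (cases "4 dvd q - 1")
    case True
    then obtain s where "[s\<^sup>2 = - 1] (mod int q)"
      using minus_one_square_iff[OF assms] by blast
    with True show ?thesis
      by (intro that[of "{s}" s]) (auto simp: card_parameters)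
  next
    case False
    then show ?thesis
      using minus_one_square_iff[OF assms] by (intro that[of "{}" 0]) (auto simp: card_parameters)
  qed
  let ?R = "\<lambda>(v, w, c, d). model (int q) v w c d"
  have "num_braces (4 * q) = card (parameters S)"
  proof (rule num_braces_eq_card[of "parameters S" ?R])
    show "finite (parameters S)"
      by (rule card_ge_0_finite) (simp add: S(4))
    show "left_brace (?R x)" if "x \<in> parameters S" for x
      using that assms S(1) by (cases x) (auto intro!: left_brace_model admissible_parameters)
    show "order (?R x) = 4 * q" for x
      by (cases x) (simp add: order_model)
    show "x = y" if "x \<in> parameters S" "y \<in> parameters S" "brace_isomorphic (?R x) (?R y)" for x y
      using that parameters_eq_if_model_isomorphic[OF assms S(1,2)]
      by (cases x; cases y) auto
    show "\<exists>x\<in>parameters S. brace_isomorphic (?R x) A" if "A \<in> braces_of_order (4 * q)" for A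
    proof -
      have "left_brace A" "order A = 4 * q"
        using that by (auto simp: braces_of_order_def)
      then obtain g K where "brace_4q A q g K"
        using left_brace.brace_4q_exists[OF _ assms] by blast
      then interpret brace_4q A q g K .
      obtain v w c d where "(v, w, c, d) \<in> parameters S"
        "brace_isomorphic (model (int q) v w c d) A"
        using isomorphic_model_exists[of S] S(3) by blast
      then show ?thesis
        by (intro bexI[of _ "(v, w, c, d)"]) simp_all
    qed
  qed
  then show ?thesis
    using S(4) by simp
qed

end
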